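(* Let $A\subset\{0,1,2,\dots\}$ be the set of all $n\ge 0$ such that for every $k\ge 0$ the set $B_k=\{2^k,2^k+1,\dots,2^{k+1}-1\}$ is not contained in $\mathrm{supp}(n)$. Let $T$ be the theory of $(\mathbb{Z},+,A)$, with $A$ the interpretation of a unary predicate $\mathbb{A}$, let $(\mathbb{M},+,\mathbb{A})$ be a monster model of $T$, and let $G=(\mathbb{M},+)$. Then the definable group $G$ in $T$ does not have the J-property.
   Context: For an integer $n\ge 0$ with binary expansion $n=\sum_i\epsilon(i)2^i$, $\epsilon(i)\in\{0,1\}$, $\mathrm{supp}(n)=\{i : \epsilon(i)=1\}$ (so $\mathrm{supp}(0)=\emptyset$). For $m\ge 1$ let $\mathfrak{j}_m=\{s\in\mathbb{N}^m : s(1)<s(2)<\dots<s(m)\}$, where $\mathbb{N}=\{1,2,\dots\}$. For a model $M$ over which a group $G$ is definable, $m\ge 1$, $a\in G(M)^{m+1}$, $t\in\mathfrak{j}_m$ and $f\in G(M)^{\mathbb{N}}$, put (multiplicative notation for the group law) $\chi(m,a,t,f)=a(1)f(t(1))a(2)f(t(2))\cdots a(m)f(t(m))a(m+1)$. A subset $X\subset G(M)$ is a J-set of $G$ in $M$ if for every finite $F\subset G(M)^{\mathbb{N}}$ there are $m\ge 1$, $t\in\mathfrak{j}_m$ and $a\in G(M)^{m+1}$ such that $\chi(m,a,t,f)\in X$ for every $f\in F$. A subset $X\subset G(M)$ is generic if $G(M)$ is covered by finitely many left translates of $X$; $X$ is weakly generic if $X\cup Y$ is generic for some non-generic $Y\subset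 G(M)$. A definable group $G$ has the J-property if for some (equivalently, any) $\aleph_0$-saturated model $M$ (over which $G$ is definable; e.g. the monster model), the definable subsets of $G(M)$ that are J-sets of $G$ in $M$ coincide with those that are weakly generic in $G(M)$. *)

theory Defs
  imports Main "HOL-Algebra.Coset"
begin

text \<open>Variables are named by natural numbers (no de Bruijn indices).\<close>

datatype tm = Var nat | Plus tm tm

datatype fm = Eq tm tm | Pred tm | Neg fm | Conj fm fm | All nat fm

primrec tm_vars :: "tm \<Rightarrow> nat set" where
  "tm_vars (Var i) = {i}"
| "tm_vars (Plus s t) = tm_vars s \<union> tm_vars t"

primrec free_vars :: "fm \<Rightarrow> nat set" where
  "free_vars (Eq s t) = tm_vars s \<union> tm_vars t"
| "free_vars (Pred t) = tm_vars t"
| "free_vars (Neg \<phi>) = free_vars \<phi>"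
| "free_vars (Conj \<phi> \<psi>) = free_vars \<phi> \<union> free_vars \<psi>"
| "free_vars (All i \<phi>) = free_vars \<phi> - {i}"

record 'a struct =
  univ :: "'a set"
  add :: "'a \<Rightarrow> 'a \<Rightarrow> 'a"
  pred :: "'a set"

definition is_struct :: "'a struct \<Rightarrow> bool" where
  "is_struct M \<longleftrightarrow> univ M \<noteq> {} \<and> pred M \<subseteq> univ M \<and>
     (\<forall>x\<in>univ M. \<forall>y\<in>univ M. add M x y \<in> univ M)"

primrec tm_val :: "'a struct \<Rightarrow> (nat \<Rightarrow> 'a) \<Rightarrow> tm \<Rightarrow> 'a" where
  "tm_val M e (Var i) = e i"
| "tm_val M e (Plus s t) = add M (tm_val M e s) (tm_val M e t)"

primrec sat :: "'a struct \<Rightarrow> (nat \<Rightarrow> 'a) \<Rightarrow> fm \<Rightarrow> bool" where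
  "sat M e (Eq s t) \<longleftrightarrow> tm_val M e s = tm_val M e t"
| "sat M e (Pred t) \<longleftrightarrow> tm_val M e t \<in> pred M"
| "sat M e (Neg \<phi>) \<longleftrightarrow> \<not> sat M e \<phi>"
| "sat M e (Conj \<phi> \<psi>) \<longleftrightarrow> sat M e \<phi> \<and> sat M e \<psi>"
| "sat M e (All i \<phi>) \<longleftrightarrow> (\<forall>x\<in>univ M. sat M (e(i := x)) \<phi>)"

definition holds :: "'a struct \<Rightarrow> fm \<Rightarrow> bool" where
  "holds M \<phi> \<longleftrightarrow> (\<forall>e. range e \<subseteq> univ M \<longrightarrow> sat M e \<phi>)"

definition theory_of :: "'a struct \<Rightarrow> fm set" where
  "theory_of M = {\<phi>. free_vars \<phi> = {} \<and> holds M \<phi>}"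

definition is_model :: "'a struct \<Rightarrow> fm set \<Rightarrow> bool" where
  "is_model M T \<longleftrightarrow> is_struct M \<and> (\<forall>\<phi>\<in>T. holds M \<phi>)"

text \<open>A formula with parameters is a formula together with a list \<open>bs\<close> of elements: variable
  \<open>0\<close> is the object variable and variable \<open>Suc i\<close> stands for the parameter \<open>bs ! i\<close>. The bound
  on the free variables ensures that the values of \<open>nth\<close> beyond the list play no role.\<close>

definition definable :: "'a struct \<Rightarrow> 'a set \<Rightarrow> bool" where
  "definable M X \<longleftrightarrow> (\<exists>\<phi> bs. set bs \<subseteq> univ M \<and> free_vars \<phi> \<subseteq> {..length bs} \<and>
     X = {x \<in> univ M. sat M (nth (x # bs)) \<phi>})"

text \<open>As usual, it suffices to realize types in one variable; \<open>p\<close> need not be complete.\<close>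

definition aleph0_saturated :: "'a struct \<Rightarrow> bool" where
  "aleph0_saturated M \<longleftrightarrow> (\<forall>bs p. set bs \<subseteq> univ M \<longrightarrow>
     (\<forall>\<phi>\<in>p. free_vars \<phi> \<subseteq> {..length bs}) \<longrightarrow>
     (\<forall>q. finite q \<and> q \<subseteq> p \<longrightarrow> (\<exists>x\<in>univ M. \<forall>\<phi>\<in>q. sat M (nth (x # bs)) \<phi>)) \<longrightarrow>
     (\<exists>x\<in>univ M. \<forall>\<phi>\<in>p. sat M (nth (x # bs)) \<phi>))"

text \<open>Sequences are indexed by the positive integers, so tuples and sequences are extensional
  functions on \<open>{1..m}\<close> and \<open>{1..}\<close>.\<close>

definition incr_tuples :: "nat \<Rightarrow> (nat \<Rightarrow> nat) set" where
  "incr_tuples m = {s \<in> {1..m} \<rightarrow>\<^sub>E {1..}. strict_mono_on {1..m} s}"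

text \<open>\<open>chi G m a t f\<close> is the product
  \<open>a 1 \<cdot> f (t 1) \<cdot> a 2 \<cdot> f (t 2) \<cdot> \<dots> \<cdot> a m \<cdot> f (t m) \<cdot> a (m + 1)\<close>.\<close>

primrec chi :: "('a, 'b) monoid_scheme \<Rightarrow> nat \<Rightarrow> (nat \<Rightarrow> 'a) \<Rightarrow> (nat \<Rightarrow> nat) \<Rightarrow> (nat \<Rightarrow> 'a) \<Rightarrow> 'a" where
  "chi G 0 a t f = a 1"
| "chi G (Suc m) a t f = chi G m a t f \<otimes>\<^bsub>G\<^esub> f (t (Suc m)) \<otimes>\<^bsub>G\<^esub> a (Suc (Suc m))"

definition J_set :: "('a, 'b) monoid_scheme \<Rightarrow> 'a set \<Rightarrow> bool" where
  "J_set G X \<longleftrightarrow> X \<subseteq> carrier G \<and>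
     (\<forall>F. finite F \<and> F \<subseteq> ({1..} \<rightarrow>\<^sub>E carrier G) \<longrightarrow>
        (\<exists>m\<ge>1. \<exists>t\<in>incr_tuples m. \<exists>a\<in>{1..m+1} \<rightarrow>\<^sub>E carrier G. \<forall>f\<in>F. chi G m a t f \<in> X))"

definition generic :: "('a, 'b) monoid_scheme \<Rightarrow> 'a set \<Rightarrow> bool" where
  "generic G X \<longleftrightarrow> X \<subseteq> carrier G \<and>
     (\<exists>C. finite C \<and> C \<subseteq> carrier G \<and> carrier G = (\<Union>g\<in>C. g <#\<^bsub>G\<^esub> X))"

definition weakly_generic :: "('a, 'b) monoid_scheme \<Rightarrow> 'a set \<Rightarrow> bool" where
  "weakly_generic G X \<longleftrightarrow> X \<subseteq> carrier G \<and>
     (\<exists>Y. Y \<subseteq> carrier G \<and> \<not> generic G Y \<and> generic G (X \<union> Y))"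

text \<open>The defining condition of the J-property, read in one model \<open>M\<close>, for a definable group
  \<open>G\<close> whose elements are elements (rather than longer tuples) of \<open>M\<close>. The J-property itself is
  this condition for an \<open>\<aleph>\<^sub>0\<close>-saturated \<open>M\<close>, the choice of which does not matter.\<close>

definition J_property_in :: "'a struct \<Rightarrow> ('a, 'b) monoid_scheme \<Rightarrow> bool" where
  "J_property_in M G \<longleftrightarrow>
     {X. X \<subseteq> carrier G \<and> definable M X \<and> J_set G X} =
     {X. X \<subseteq> carrier G \<and> definable M X \<and> weakly_generic G X}"

text \<open>The language has no symbol for the neutral element, so it is recovered from the addition.\<close>

definition additive_group :: "'a struct \<Rightarrow> 'a monoid" where
  "additive_group M = \<lparr>carrier = univ M, monoid.mult = add M,
     one = (THE z. z \<in> univ M \<and> (\<forall>x\<in>univ M. add M z x = x \<and> add M x z = x))\<rparr>"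

definition supp :: "nat \<Rightarrow> nat set" where
  "supp n = {i. bit n i}"

definition A_set :: "nat set" where
  "A_set = {n. \<forall>k. \<not> {2 ^ k..2 ^ (k + 1) - 1} \<subseteq> supp n}"

definition int_struct :: "int struct" where
  "int_struct = \<lparr>univ = UNIV, add = (+), pred = int ` A_set\<rparr>"

end

theory Submission
  imports Defs "HOL-Library.Nat_Bijection"
begin

text \<open>
  The definable set that separates the two notions is the predicate \<open>A\<close> itself: in every model of
  the theory it is a J-set, but it is not weakly generic. Call \<open>{2^k..<2^(k+1)}\<close> the \<open>k\<close>-th block of
  binary digits. An integer lies in \<open>A\<close> iff it is nonnegative and none of its blocks consists of
  ones only. As the lengths of the blocks grow, a full block is a rare event, which makes \<open>A\<close> rich
  enough to be a J-set; but filling a block is a condition on a residue class, so integers outside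
  \<open>A\<close> occur with bounded gaps.

  Why \<open>A\<close> is a J-set. In a commutative group the coefficients of a product \<open>chi\<close> can be collected
  into a single translation, and it suffices to use consecutive indices of the sequences. Given \<open>n\<close>
  integer sequences, the pigeonhole principle yields \<open>p < q\<close> such that the \<open>n\<close> sums over \<open>{p..<q}\<close>
  are all divisible by \<open>2^2^n\<close>, and \<open>q\<close> is bounded in terms of \<open>n\<close> (\<open>ex_block_sum_dvd\<close>). These sums
  have no ones in the blocks below the \<open>n\<close>-th, and a common translation \<open>d\<close> that takes all of them
  into \<open>A\<close> is built block by block: block \<open>J \<ge> n\<close> has room for \<open>2^2^J > n\<close> digit strings,
  and each of the \<open>n\<close> sums excludes only one of them (\<open>ex_translate_into_A\<close>).

  Why \<open>A\<close> is not weakly generic. If \<open>X\<close> is weakly generic, then for some finite \<open>C\<close> the complement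
  of \<open>C + X\<close> is not generic. But for any \<open>n\<close> integers \<open>c\<close> there is a residue class modulo \<open>2^2^n\<close>
  whose elements \<open>x\<close> all have the property that the \<open>i\<close>-th block of \<open>x + c i\<close> is full for each
  \<open>i < n\<close> (\<open>fill_blocks\<close>). So the complement of finitely many translates of \<open>A\<close> meets all
  intervals of length \<open>2^2^n\<close>, and is generic.

  Both arguments give bounds that depend on \<open>n\<close> only. Therefore they are expressed by first-order
  formulas, one for each \<open>n\<close>, and hold in all models of the theory (\<open>ex_block_sum_translate_in_model\<close>,
  \<open>ex_shift_avoiding_translates_in_model\<close>).
\<close>

section \<open>Transfer of universally closed formulas\<close>

lemma holds_All:
  assumes "is_struct M"
  shows "holds M (All i \<phi>) \<longleftrightarrow> holds M \<phi>"
proof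
  assume H: "holds M (All i \<phi>)"
  show "holds M \<phi>"
    unfolding holds_def
  proof (intro allI impI)
    fix e :: "nat \<Rightarrow> 'a" assume e: "range e \<subseteq> univ M"
    then have "sat M (e(i := e i)) \<phi>"
      using H unfolding holds_def by (metis rangeI sat.simps(5) subsetD)
    then show "sat M e \<phi>" by simp
  qed
next
  assume H: "holds M \<phi>"
  show "holds M (All i \<phi>)"
    unfolding holds_def
  proof (intro allI impI)
    fix e :: "nat \<Rightarrow> 'a" assume e: "range e \<subseteq> univ M"
    have "range (e(i := x)) \<subseteq> univ M" if "x \<in> univ M" for x
      using e that by auto
    then show "sat M e (All i \<phi>)"
      using H by (simp add: holds_def)
  qed
qed

lemma free_vars_foldr_All: "free_vars (foldr All is \<phi>) = free_vars \<phi> - set is"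
  by (induction "is") auto

lemma holds_foldr_All: "is_struct M \<Longrightarrow> holds M (foldr All is \<phi>) \<longleftrightarrow> holds M \<phi>"
  by (induction "is") (auto simp: holds_All)

lemma finite_tm_vars: "finite (tm_vars t)"
  by (induction t) auto

lemma finite_free_vars: "finite (free_vars \<phi>)"
  by (induction \<phi>) (auto simp: finite_tm_vars)

text \<open>Elementary equivalence speaks of sentences, but \<open>holds\<close> quantifies over all assignments and so
  agrees with validity of the universal closure. Hence formulas with free variables transfer, too;
  below, arbitrary finite families of elements are the values of free variables.\<close>

lemma holds_transfer:
  assumes "is_model M (theory_of N)" "is_struct N" "holds N \<phi>"
  shows "holds M \<phi>"
proof -
  obtain "is" where "set is = free_vars \<phi>"
    using finite_list[OF finite_free_vars] by blast
  then have "foldr All is \<phi> \<in> theory_of N"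
    using assms(2,3) by (simp add: theory_of_def free_vars_foldr_All holds_foldr_All)
  then show ?thesis
    using assms(1) by (auto simp: is_model_def holds_foldr_All)
qed

lemma is_struct_int: "is_struct int_struct"
  by (simp add: is_struct_def int_struct_def)

definition ex_fm :: "nat \<Rightarrow> fm \<Rightarrow> fm" where
  "ex_fm i \<phi> = Neg (All i (Neg \<phi>))"

definition conjs_fm :: "fm list \<Rightarrow> fm" where
  "conjs_fm \<phi>s = foldr Conj \<phi>s (Eq (Var 0) (Var 0))"

definition disjs_fm :: "fm list \<Rightarrow> fm" where
  "disjs_fm \<phi>s = Neg (conjs_fm (map Neg \<phi>s))"

lemma sat_ex_fm [simp]: "sat M e (ex_fm i \<phi>) \<longleftrightarrow> (\<exists>x\<in>univ M. sat M (e(i := x)) \<phi>)"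
  by (simp add: ex_fm_def)

lemma sat_conjs_fm [simp]: "sat M e (conjs_fm \<phi>s) \<longleftrightarrow> (\<forall>\<phi>\<in>set \<phi>s. sat M e \<phi>)"
  by (induction \<phi>s) (auto simp: conjs_fm_def)

lemma sat_disjs_fm [simp]: "sat M e (disjs_fm \<phi>s) \<longleftrightarrow> (\<exists>\<phi>\<in>set \<phi>s. sat M e \<phi>)"
  by (simp add: disjs_fm_def)

lemma tm_val_foldl_Plus [simp]:
  "tm_val M e (foldl Plus s ts) = foldl (add M) (tm_val M e s) (map (tm_val M e) ts)"
  by (induction ts arbitrary: s) auto

section \<open>Digit blocks of integers\<close>

lemma not_bit_of_less_power:
  fixes x :: int
  assumes "0 \<le> x" "x < 2 ^ L" "L \<le> b"
  shows "\<not> bit x b"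
proof -
  have "(2::int)^L \<le> 2^b" using assms by simp
  then have "x div 2^b = 0" using assms by (intro div_pos_pos_trivial) linarith+
  then show ?thesis by (simp add: bit_iff_odd)
qed

text \<open>Subtracting \<open>2 ^ L\<close> from an \<open>L\<close>-digit number sets all its higher digits, as
  \<open>s - 2 ^ L\<close> is the bitwise complement of the \<open>L\<close>-digit number \<open>2 ^ L - 1 - s\<close>.\<close>

lemma bit_diff_power:
  fixes s :: int
  assumes "0 \<le> s" "s < 2 ^ L" "L \<le> b"
  shows "bit (s - 2^L :: int) b"
proof -
  have "\<not> bit (2 ^ L - 1 - s) b" using assms by (intro not_bit_of_less_power[of _ L]) auto
  moreover have "s - 2 ^ L = not (2 ^ L - 1 - s)" by (simp add: not_eq_complement)
  ultimately show ?thesis by (simp add: bit_not_iff)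
qed

text \<open>The residue is extended one block at a time: given \<open>r\<close> modulo \<open>2 ^ 2 ^ n\<close>, the digits in the
  \<open>n\<close>-th block can still be chosen freely, and they are chosen such that those of \<open>r + c n\<close>
  are all ones. Positions below \<open>2 ^ (n + 1)\<close> depend on the residue modulo \<open>2 ^ 2 ^ (n + 1)\<close> only.\<close>

lemma fill_blocks:
  fixes c :: "nat \<Rightarrow> int"
  shows "\<exists>r. \<forall>x. x mod 2 ^ 2 ^ n = r mod 2 ^ 2 ^ n \<longrightarrow>
    (\<forall>i<n. \<forall>b\<in>{2 ^ i..2 ^ (i + 1) - 1}. bit (x + c i) b)"
proof (induction n)
  case (Suc n)
  then obtain r where r: "\<And>x i b. x mod 2 ^ 2 ^ n = r mod 2 ^ 2 ^ n \<Longrightarrow> i < n \<Longrightarrow>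
      b \<in> {2 ^ i..2 ^ (i + 1) - 1} \<Longrightarrow> bit (x + c i) b"
    by metis
  define L :: nat where "L = 2 ^ n"
  have L2: "2 ^ Suc n = L + L" by (simp add: L_def)
  define s where "s = (r + c n) mod 2 ^ L"
  have s: "0 \<le> s" "s < 2 ^ L" by (simp_all add: s_def)
  (* r' + c n has the low digits s of r + c n, followed by ones only *)
  define r' where "r' = s - 2 ^ L - c n"
  have r': "r' mod 2 ^ L = r mod 2 ^ L"
  proof -
    have "r' - r = 2 ^ L * (- 1 - (r + c n) div 2 ^ L)"
      by (simp add: r'_def s_def algebra_simps flip: minus_mult_div_eq_mod)
    then show ?thesis by (simp add: mod_eq_dvd_iff)
  qed
  have "bit (x + c i) b"
    if x: "x mod 2 ^ 2 ^ Suc n = r' mod 2 ^ 2 ^ Suc n" and i: "i < Suc n"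
      and b: "b \<in> {2 ^ i..2 ^ (i + 1) - 1}" for x i b
  proof (cases "i = n")
    case True
    have "(x + c n) mod 2 ^ (L + L) = (r' + c n) mod 2 ^ (L + L)"
      using x unfolding L2 by (intro mod_add_cong) auto
    then have tb: "take_bit (L + L) (x + c n) = take_bit (L + L) (s - 2 ^ L)"
      by (simp add: take_bit_eq_mod r'_def)
    have "b \<le> 2 * L - 1" "L \<le> b" "0 < L" using b True by (auto simp: L_def)
    then have "b < L + L" "L \<le> b" by auto
    then have "bit (x + c n) b = bit (s - 2 ^ L) b"
      using arg_cong[OF tb, of "\<lambda>y. bit y b"] by (simp add: bit_take_bit_iff)
    then show ?thesis using bit_diff_power[OF s \<open>L \<le> b\<close>] True by simp
  next
    case False
    have "(2::int) ^ L dvd 2 ^ 2 ^ Suc n" by (intro le_imp_power_dvd) (simp add: L_def)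
    then have "x mod 2 ^ L = r' mod 2 ^ L"
      using x by (metis mod_mod_cancel)
    then show ?thesis using r i b False r' by (simp add: L_def)
  qed
  then show ?case by blast
qed auto

text \<open>A number whose \<open>L\<close> lowest digits are ones is congruent to \<open>- 1\<close>.\<close>

lemma power_dvd_of_low_bits:
  fixes w :: int
  assumes "\<And>b. b < L \<Longrightarrow> bit w b"
  shows "2 ^ L dvd w + 1"
proof -
  have "take_bit L w = take_bit L (-1)"
    by (rule bit_eqI) (use assms in \<open>auto simp: bit_take_bit_iff bit_mask_iff\<close>)
  then have "w mod 2^L = (-1) mod 2^L" by (simp add: take_bit_eq_mod)
  then show ?thesis by (simp add: mod_eq_dvd_iff)
qed

text \<open>Each \<open>w i\<close> forbids one of the \<open>2 ^ L\<close> residues.\<close>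

lemma ex_digits_avoiding:
  fixes w :: "nat \<Rightarrow> int"
  assumes "n < 2 ^ L"
  shows "\<exists>e. 0 \<le> e \<and> e < 2 ^ L \<and> (\<forall>i<n. \<not> 2 ^ L dvd w i + e + 1)"
proof -
  let ?bad = "(\<lambda>i. (- w i - 1) mod 2 ^ L) ` {..<n}"
  have "card ?bad < card {0..<2 ^ L :: int}"
  proof -
    have "card ?bad \<le> n" using card_image_le[of "{..<n}"] by simp
    also have "n < card {0..<2 ^ L :: int}" using assms by (simp add: nat_power_eq)
    finally show ?thesis .
  qed
  then obtain e where e: "e \<in> {0..<2 ^ L}" "e \<notin> ?bad"
    by (metis card_mono finite_imageI finite_lessThan leD subsetI)
  have "\<not> 2 ^ L dvd w i + e + 1" if "i < n" for i
  proof
    assume "2 ^ L dvd w i + e + 1"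
    then have "2 ^ L dvd e - (- w i - 1)" by (simp add: algebra_simps)
    then have "e mod 2 ^ L = (- w i - 1) mod 2 ^ L" by (simp add: mod_eq_dvd_iff)
    then show False using e that by auto
  qed
  then show ?thesis using e by auto
qed

text \<open>Step from \<open>J\<close> to \<open>J + 1\<close>: adding \<open>2 ^ 2 ^ J * e\<close> leaves the blocks below the \<open>J\<close>-th unchanged and
  adds \<open>e\<close> to the digits in the \<open>J\<close>-th block of each \<open>d + z i\<close>, so that \<open>e\<close> can be chosen by
  \<open>ex_digits_avoiding\<close>. The bound on \<open>d\<close> controls the digits above the last block treated.\<close>

lemma ex_multiple_no_full_block:
  fixes z :: "nat \<Rightarrow> int"
  assumes n: "n < 2 ^ 2 ^ k"
  assumes "k \<le> J"
  shows "\<exists>d. 0 \<le> d \<and> d < 2 ^ 2 ^ J \<and> 2 ^ 2 ^ k dvd d \<and>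
      (\<forall>i<n. \<forall>j\<in>{k..<J}. \<exists>b\<in>{2 ^ j..2 ^ (j + 1) - 1}. \<not> bit (d + z i) b)"
  using \<open>k \<le> J\<close>
proof (induction J rule: dec_induct)
  case (step J)
  then obtain d where d: "0 \<le> d" "d < 2 ^ 2 ^ J" "2 ^ 2 ^ k dvd d"
    and av: "\<And>i j. i < n \<Longrightarrow> j \<in> {k..<J} \<Longrightarrow> \<exists>b\<in>{2 ^ j..2 ^ (j + 1) - 1}. \<not> bit (d + z i) b"
    by blast
  define L :: nat where "L = 2 ^ J"
  have L2: "2 ^ Suc J = L + L" by (simp add: L_def)
  have kL: "2 ^ k \<le> L" using step by (simp add: L_def)
  have "n < 2 ^ L" using n kL by (meson le_less_trans less_le_trans one_le_numeral power_increasing)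
  then obtain e where e: "0 \<le> e" "e < 2 ^ L" 
    and e': "\<And>i. i < n \<Longrightarrow> \<not> 2 ^ L dvd (d + z i) div 2 ^ L + e + 1"
    using ex_digits_avoiding[of n L "\<lambda>i. (d + z i) div 2 ^ L"] by blast
  define d' where "d' = d + 2 ^ L * e"
  have "0 \<le> d'" using d e by (simp add: d'_def)
  moreover have "d' < 2 ^ 2 ^ Suc J"
  proof -
    have "d' < 2 ^ L + 2 ^ L * e" using d by (simp add: d'_def L_def)
    also have "\<dots> = 2 ^ L * (e + 1)" by (simp add: algebra_simps)
    also have "\<dots> \<le> 2 ^ L * 2 ^ L" using e by (intro mult_left_mono) auto
    finally show ?thesis by (simp only: L2 power_add)
  qed
  moreover have "2 ^ 2 ^ k dvd d'"
    unfolding d'_def using d(3) kL by (intro dvd_add dvd_mult2 le_imp_power_dvd)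
  moreover have "\<exists>b\<in>{2 ^ j..2 ^ (j + 1) - 1}. \<not> bit (d' + z i) b"
    if i: "i < n" and j: "j \<in> {k..<Suc J}" for i j
  proof (cases "j = J")
    case True
    show ?thesis
    proof (rule ccontr)
      assume "\<not> ?thesis"
      then have full: "bit (d' + z i) (L + b)" if "b < L" for b
        using that True by (auto simp: L_def)
      have eq: "(d' + z i) div 2 ^ L = (d + z i) div 2 ^ L + e"
        using div_mult_self2[of "2 ^ L" "d + z i" e] by (simp add: d'_def algebra_simps)
      have "bit ((d' + z i) div 2 ^ L) b" if "b < L" for b
        using full[OF that] by (simp add: bit_drop_bit_eq flip: drop_bit_eq_div)
      then have "2 ^ L dvd (d' + z i) div 2 ^ L + 1" by (rule power_dvd_of_low_bits)
      then show False using e'[OF i] by (simp add: eq)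
    qed
  next
    case False
    then obtain b where b: "b \<in> {2 ^ j..2 ^ (j + 1) - 1}" "\<not> bit (d + z i) b"
      using av i j by force
    have "(2::nat) ^ (j + 1) \<le> L" using False j unfolding L_def by (intro power_increasing) auto
    moreover have "(2::nat) ^ (j + 1) > 0" by simp
    ultimately have "b < L" using b(1) unfolding atLeastAtMost_iff by linarith
    moreover have "take_bit L (d' + z i) = take_bit L (d + z i)"
      unfolding d'_def take_bit_eq_mod
      using mod_mult_self2[of "d + z i" "2 ^ L" e] by (simp add: algebra_simps)
    ultimately have "\<not> bit (d' + z i) b"
      using b by (metis bit_take_bit_iff)
    then show ?thesis using b by blast
  qed
  ultimately show ?case by blast
qed auto

lemma mem_int_A_set_iff:
  "x \<in> int ` A_set \<longleftrightarrow> 0 \<le> x \<and> (\<forall>k. \<exists>b\<in>{2 ^ k..2 ^ (k + 1) - 1}. \<not> bit x b)"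
proof (cases "0 \<le> x")
  case True
  then obtain n where n: "x = int n" by (metis nonneg_int_cases)
  have "bit (int n) b = bit n b" for b
    by (simp add: bit_of_nat_iff_bit)
  then show ?thesis
    unfolding n A_set_def supp_def by (auto simp: subset_eq)
qed auto

text \<open>The bound \<open>P\<close> is the modulus in \<open>fill_blocks\<close>: any \<open>P\<close> consecutive integers represent all residues.
  It depends neither on \<open>c\<close> nor on \<open>z\<close>, so the property is first-order.\<close>

lemma ex_bounded_shift_outside_A:
  "\<exists>P. \<forall>(c :: nat \<Rightarrow> int) z. \<exists>j<P. \<forall>i<n. z + int j + c i \<notin> int ` A_set"
proof (rule exI[of _ "2 ^ 2 ^ n"], intro allI)
  fix c :: "nat \<Rightarrow> int" and z :: int
  obtain r where r: "\<And>x i b. x mod 2 ^ 2 ^ n = r mod 2 ^ 2 ^ n \<Longrightarrow> i < n \<Longrightarrow>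
      b \<in> {2 ^ i..2 ^ (i + 1) - 1} \<Longrightarrow> bit (x + c i) b"
    using fill_blocks by metis
  define j where "j = nat ((r - z) mod 2 ^ 2 ^ n)"
  have j: "int j = (r - z) mod 2 ^ 2 ^ n" by (simp add: j_def)
  have "(z + int j) mod 2 ^ 2 ^ n = r mod 2 ^ 2 ^ n"
    unfolding j by (simp add: mod_add_right_eq)
  then have "z + int j + c i \<notin> int ` A_set" if "i < n" for i
    using r[of "z + int j" i] that unfolding mem_int_A_set_iff by blast
  moreover have "int j < int (2 ^ 2 ^ n)" unfolding j by simp
  then have "j < 2 ^ 2 ^ n" by (simp only: of_nat_less_iff)
  ultimately show "\<exists>j<2 ^ 2 ^ n. \<forall>i<n. z + int j + c i \<notin> int ` A_set" by blast
qed

lemma not_bit_of_power_dvd: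
  fixes x :: int
  assumes "2 ^ L dvd x" "b < L"
  shows "\<not> bit x b"
proof -
  have "take_bit L x = 0" using assms(1) by (simp add: take_bit_eq_mod)
  then show ?thesis using assms(2) by (metis bit_0_eq bit_take_bit_iff bot_apply bot_bool_def)
qed

text \<open>Three ranges of blocks: those below the \<open>k\<close>-th vanish in \<open>d + z i\<close> by divisibility, those from \<open>k\<close> to
  \<open>J - 1\<close> are handled by the choice of \<open>d\<close>, and from \<open>J\<close> on the top position of the block lies
  beyond the digits of \<open>d + z i\<close>.\<close>

lemma ex_translate_into_A_nonneg:
  fixes z :: "nat \<Rightarrow> int"
  assumes n: "n < 2 ^ 2 ^ k" and z: "\<And>i. i < n \<Longrightarrow> 2 ^ 2 ^ k dvd z i"
    and pos: "\<And>i. i < n \<Longrightarrow> 0 \<le> z i"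
  shows "\<exists>d. \<forall>i<n. d + z i \<in> int ` A_set"
proof -
  define J where "J = nat (\<Sum>i<n. z i) + k + 1"
  have zJ: "z i < 2 ^ 2 ^ J" if "i < n" for i
  proof -
    have "z i \<le> (\<Sum>i<n. z i)" using that pos by (intro member_le_sum) auto
    also have "\<dots> \<le> int J" by (simp add: J_def)
    also have "\<dots> < int (2 ^ J)" by (simp only: of_nat_less_iff less_exp)
    also have "\<dots> < int (2 ^ 2 ^ J)" by (simp only: of_nat_less_iff less_exp)
    finally show ?thesis by simp
  qed
  have "k \<le> J" by (simp add: J_def)
  then obtain d where d: "0 \<le> d" "d < 2 ^ 2 ^ J" "2 ^ 2 ^ k dvd d"
    and av: "\<And>i j. i < n \<Longrightarrow> j \<in> {k..<J} \<Longrightarrow> \<exists>b\<in>{2 ^ j..2 ^ (j + 1) - 1}. \<not> bit (d + z i) b"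
    using ex_multiple_no_full_block[OF n] by metis
  have "\<exists>b\<in>{2 ^ j..2 ^ (j + 1) - 1}. \<not> bit (d + z i) b" if i: "i < n" for i j
  proof -
    consider "j < k" | "j \<in> {k..<J}" | "J \<le> j" by force
    then show ?thesis
    proof cases
      case 1
      have "2 ^ 2 ^ k dvd d + z i" using d(3) z[OF i] by simp
      then have "\<not> bit (d + z i) (2 ^ j)" by (rule not_bit_of_power_dvd) (use 1 in simp)
      then show ?thesis by (intro bexI[of _ "2 ^ j"]) auto
    next
      case 2
      then show ?thesis using av i by blast
    next
      case 3
      (* d + z i < 2 ^ (2 ^ J + 1); the summand 1 in J ensures 2 ^ J + 1 < 2 ^ (J + 1) *)
      have "(2::nat) \<le> 2 ^ J" unfolding J_def by simp
      moreover have "(2::nat) ^ J \<le> 2 ^ j" using 3 by simp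
      ultimately have le: "2 ^ J + 1 \<le> (2::nat) ^ (j + 1) - 1"
        unfolding power_add power_one_right by linarith
      have "d + z i < 2 ^ (2 ^ J + 1)" using d(2) zJ[OF i] by simp
      then have "\<not> bit (d + z i) (2 ^ (j + 1) - 1)"
        using not_bit_of_less_power[OF _ _ le] d(1) pos[OF i] by simp
      then show ?thesis by (intro bexI[of _ "2 ^ (j + 1) - 1"]) auto
    qed
  qed
  then show ?thesis using d(1) pos by (intro exI[of _ d]) (simp add: mem_int_A_set_iff)
qed

lemma ex_translate_into_A:
  fixes z :: "nat \<Rightarrow> int"
  assumes n: "n < 2 ^ 2 ^ k" and z: "\<And>i. i < n \<Longrightarrow> 2 ^ 2 ^ k dvd z i"
  shows "\<exists>d. \<forall>i<n. d + z i \<in> int ` A_set"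
proof -
  (* a translation that makes all z i nonnegative and preserves divisibility *)
  define s where "s = 2 ^ 2 ^ k * (\<Sum>i<n. \<bar>z i\<bar>)"
  have "0 \<le> s + z i" if "i < n" for i
  proof -
    have "\<bar>z i\<bar> \<le> (\<Sum>i<n. \<bar>z i\<bar>)" using that by (intro member_le_sum) auto
    also have "\<dots> \<le> s" unfolding s_def
      using mult_right_mono[of 1 "2 ^ 2 ^ k" "\<Sum>i<n. \<bar>z i\<bar>"] by (simp add: sum_nonneg)
    finally show ?thesis by simp
  qed
  moreover have "2 ^ 2 ^ k dvd s + z i" if "i < n" for i
    using z[OF that] by (simp add: s_def)
  ultimately obtain d where "\<forall>i<n. d + (s + z i) \<in> int ` A_set"
    using ex_translate_into_A_nonneg[OF n, of "\<lambda>i. s + z i"] by blast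
  then show ?thesis by (intro exI[of _ "d + s"]) (simp add: add.assoc)
qed

text \<open>Pigeonhole principle for the vectors of residues of the \<open>n\<close> sums over \<open>{0..<q}\<close>: two of them
  coincide as soon as there are more values of \<open>q\<close> than vectors.\<close>

lemma ex_block_sum_dvd:
  fixes m :: int
  assumes "0 < m"
  shows "\<exists>N. \<forall>y :: nat \<Rightarrow> nat \<Rightarrow> int. \<exists>p q. p < q \<and> q \<le> N \<and>
    (\<forall>i<n. m dvd sum_list (map (y i) [p..<q]))"
proof -
  define R where "R = {..<n} \<rightarrow>\<^sub>E {0..<m}"
  have "\<exists>p q. p < q \<and> q \<le> card R \<and> (\<forall>i<n. m dvd sum_list (map (y i) [p..<q]))"
    for y :: "nat \<Rightarrow> nat \<Rightarrow> int"
  proof -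
    define S where "S q = (\<lambda>i\<in>{..<n}. sum_list (map (y i) [0..<q]) mod m)" for q
    have fin: "finite R" unfolding R_def by (intro finite_PiE) auto
    moreover have "S ` {..card R} \<subseteq> R" using assms by (auto simp: S_def R_def split: if_splits)
    ultimately have "\<not> inj_on S {..card R}"
      using card_inj_on_le[of S "{..card R}" R] by auto
    then obtain p q where pq: "p < q" "q \<le> card R" "S p = S q"
      unfolding inj_on_def by (metis atMost_iff nat_neq_iff)
    have "m dvd sum_list (map (y i) [p..<q])" if "i < n" for i
    proof -
      have "[0..<q] = [0..<p] @ [p..<q]"
        using pq(1) upt_add_eq_append[of 0 p "q - p"] by simp
      then have "sum_list (map (y i) [0..<q]) = sum_list (map (y i) [0..<p])
          + sum_list (map (y i) [p..<q])"
        by simp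
      moreover have "sum_list (map (y i) [0..<q]) mod m = sum_list (map (y i) [0..<p]) mod m"
        using fun_cong[OF pq(3), of i] that by (simp add: S_def)
      ultimately show ?thesis by (metis add_diff_cancel_left' mod_eq_dvd_iff)
    qed
    then show ?thesis using pq by blast
  qed
  then show ?thesis by blast
qed

lemma ex_block_sum_translate_into_A:
  "\<exists>N. \<forall>y :: nat \<Rightarrow> nat \<Rightarrow> int. \<exists>p q. p < q \<and> q \<le> N \<and>
     (\<exists>d. \<forall>i<n. d + sum_list (map (y i) [p..<q]) \<in> int ` A_set)"
proof -
  have n: "n < 2 ^ 2 ^ n" by (meson less_exp less_trans)
  obtain N where N: "\<And>y :: nat \<Rightarrow> nat \<Rightarrow> int. \<exists>p q. p < q \<and> q \<le> N \<and>
      (\<forall>i<n. 2 ^ 2 ^ n dvd sum_list (map (y i) [p..<q]))"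
    using ex_block_sum_dvd[of "2 ^ 2 ^ n" n] by auto
  have "\<exists>p q. p < q \<and> q \<le> N \<and> (\<exists>d. \<forall>i<n. d + sum_list (map (y i) [p..<q]) \<in> int ` A_set)"
    for y :: "nat \<Rightarrow> nat \<Rightarrow> int"
  proof -
    obtain p q where "p < q" "q \<le> N" "\<And>i. i < n \<Longrightarrow> 2 ^ 2 ^ n dvd sum_list (map (y i) [p..<q])"
      using N[of y] by blast
    then show ?thesis
      using ex_translate_into_A[OF n, of "\<lambda>i. sum_list (map (y i) [p..<q])"] by blast
  qed
  then show ?thesis by blast
qed

section \<open>First-order forms of the two properties of A\<close>

lemma foldl_add_eq: "foldl (+) x xs = x + sum_list xs" for x :: int
  by (induction xs arbitrary: x) auto

lemma ball_upt: "(\<forall>i\<in>{0..<n}. P i) \<longleftrightarrow> (\<forall>i<n. P i)" for n :: nat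
  by auto

lemma bex_upt: "(\<exists>i\<in>{0..<n}. P i) \<longleftrightarrow> (\<exists>i<n. P i)" for n :: nat
  by auto

text \<open>Variable 0 is the translation; variable \<open>Suc (prod_encode (i, t))\<close> is entry \<open>t\<close> of the \<open>i\<close>-th
  sequence. The disjunctions over \<open>p\<close> and \<open>q\<close> are finite because the index bound \<open>N\<close> is uniform.\<close>

definition block_sum_fm :: "nat \<Rightarrow> nat \<Rightarrow> fm" where
  "block_sum_fm n N = disjs_fm [ex_fm 0 (conjs_fm [Pred (foldl Plus (Var 0)
      (map (\<lambda>t. Var (Suc (prod_encode (i, t)))) [p..<q])). i \<leftarrow> [0..<n]]).
      q \<leftarrow> [0..<Suc N], p \<leftarrow> [0..<q]]"

lemma sat_block_sum_fm:
  "sat M e (block_sum_fm n N) \<longleftrightarrow> (\<exists>q\<le>N. \<exists>p<q. \<exists>d\<in>univ M. \<forall>i<n.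
     foldl (add M) d (map (\<lambda>t. e (Suc (prod_encode (i, t)))) [p..<q]) \<in> pred M)"
  unfolding block_sum_fm_def
  by (simp add: comp_def ball_upt bex_upt less_Suc_eq_le del: upt_Suc)

lemma ex_block_sum_translate_in_model:
  fixes n :: nat
  assumes M: "is_model M (theory_of int_struct)"
    and y: "\<And>i t. y i t \<in> univ M"
  shows "\<exists>p q. p < q \<and> (\<exists>d\<in>univ M. \<forall>i<n. foldl (add M) d (map (y i) [p..<q]) \<in> pred M)"
proof -
  obtain N where N: "\<And>y :: nat \<Rightarrow> nat \<Rightarrow> int. \<exists>p q. p < q \<and> q \<le> N \<and>
     (\<exists>d. \<forall>i<n. d + sum_list (map (y i) [p..<q]) \<in> int ` A_set)"
    using ex_block_sum_translate_into_A[of n] by auto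
  have "sat int_struct e (block_sum_fm n N)" for e
    using N[of "\<lambda>i t. e (Suc (prod_encode (i, t)))"]
    by (auto simp: sat_block_sum_fm int_struct_def foldl_add_eq)
  then have "holds M (block_sum_fm n N)"
    using holds_transfer[OF M is_struct_int] by (simp add: holds_def)
  moreover define e where "e v = (case v of 0 \<Rightarrow> y 0 0 | Suc w \<Rightarrow> case_prod y (prod_decode w))" for v
  have "range e \<subseteq> univ M"
    using y by (auto simp: e_def split: nat.split prod.split)
  ultimately have "sat M e (block_sum_fm n N)" by (simp add: holds_def)
  then show ?thesis by (auto simp: sat_block_sum_fm e_def)
qed

text \<open>Variable 0 is the unit \<open>u\<close> of the shifts, variable 1 the element \<open>z\<close> that is shifted, and variable
  \<open>i + 2\<close> is \<open>c i\<close>. The number 1 has no name in the language, but some \<open>u\<close> that serves in its place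
  is enough.\<close>

definition shift_fm :: "nat \<Rightarrow> nat \<Rightarrow> fm" where
  "shift_fm n P = ex_fm 0 (All 1 (disjs_fm [conjs_fm [Neg (Pred
      (Plus (foldl Plus (Var 1) (replicate j (Var 0))) (Var (i + 2)))). i \<leftarrow> [0..<n]].
      j \<leftarrow> [0..<P]]))"

lemma sat_shift_fm:
  "sat M e (shift_fm n P) \<longleftrightarrow> (\<exists>u\<in>univ M. \<forall>z\<in>univ M. \<exists>j<P. \<forall>i<n.
     add M (foldl (add M) z (replicate j u)) (e (i + 2)) \<notin> pred M)"
  unfolding shift_fm_def by (simp add: comp_def ball_upt bex_upt)

lemma ex_shift_avoiding_translates_in_model:
  fixes n :: nat
  assumes M: "is_model M (theory_of int_struct)"
    and c: "\<And>i. c i \<in> univ M"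
  shows "\<exists>P. \<exists>u\<in>univ M. \<forall>z\<in>univ M. \<exists>j<P. \<forall>i<n.
    add M (foldl (add M) z (replicate j u)) (c i) \<notin> pred M"
proof -
  obtain P where P: "\<And>(c :: nat \<Rightarrow> int) z. \<exists>j<P. \<forall>i<n. z + int j + c i \<notin> int ` A_set"
    using ex_bounded_shift_outside_A[of n] by auto
  have "sat int_struct e (shift_fm n P)" for e
    unfolding sat_shift_fm using P[of _ "\<lambda>i. e (i + 2)"]
    by (intro bexI[of _ 1]) (auto simp: int_struct_def foldl_add_eq sum_list_replicate)
  then have "holds M (shift_fm n P)"
    using holds_transfer[OF M is_struct_int] by (simp add: holds_def)
  moreover have "range (\<lambda>v. c (v - 2)) \<subseteq> univ M" using c by blast
  ultimately have "sat M (\<lambda>v. c (v - 2)) (shift_fm n P)" unfolding holds_def by blast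
  then show ?thesis unfolding sat_shift_fm by auto
qed

section \<open>Genericity and J-sets in the additive group\<close>

lemma additive_group_sel [simp]:
  "carrier (additive_group M) = univ M" "monoid.mult (additive_group M) = add M"
  by (simp_all add: additive_group_def)

text \<open>All axioms follow from associativity, commutativity and the solvability of \<open>w + x = y\<close>, each of
  which is the validity of a formula that transfers from the integers.\<close>

lemma comm_group_additive_group:
  assumes M: "is_model M (theory_of int_struct)"
  shows "comm_group (additive_group M)"
proof -
  note transfer = holds_transfer[OF M is_struct_int]
  have M': "is_struct M" using M by (simp add: is_model_def)
  then have closed: "add M x y \<in> univ M" if "x \<in> univ M" "y \<in> univ M" for x y
    using that by (simp add: is_struct_def)
  have assoc: "add M (add M x y) z = add M x (add M y z)"
    if "x \<in> univ M" "y \<in> univ M" "z \<in> univ M" for x y z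
  proof -
    have "holds M (Eq (Plus (Plus (Var 0) (Var 1)) (Var 2)) (Plus (Var 0) (Plus (Var 1) (Var 2))))"
      by (rule transfer) (simp add: holds_def int_struct_def)
    from this[unfolded holds_def, rule_format, of "(\<lambda>_. x)(1 := y, 2 := z)"] show ?thesis
      using that by auto
  qed
  have comm: "add M x y = add M y x" if "x \<in> univ M" "y \<in> univ M" for x y
  proof -
    have "holds M (Eq (Plus (Var 0) (Var 1)) (Plus (Var 1) (Var 0)))"
      by (rule transfer) (simp add: holds_def int_struct_def)
    from this[unfolded holds_def, rule_format, of "(\<lambda>_. x)(1 := y)"] show ?thesis
      using that by auto
  qed
  have solve: "\<exists>w\<in>univ M. add M w x = y" if "x \<in> univ M" "y \<in> univ M" for x y
  proof -
    have "\<exists>w. w + a = b" for a b :: int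
      by (rule exI[of _ "b - a"]) simp
    then have "holds M (ex_fm 2 (Eq (Plus (Var 2) (Var 0)) (Var 1)))"
      by (intro transfer) (simp add: holds_def int_struct_def)
    from this[unfolded holds_def, rule_format, of "(\<lambda>_. x)(1 := y)"] show ?thesis
      using that by auto
  qed
  let ?zero = "\<lambda>z. z \<in> univ M \<and> (\<forall>x\<in>univ M. add M z x = x \<and> add M x z = x)"
  obtain x0 where x0: "x0 \<in> univ M" using M' by (auto simp: is_struct_def)
  (* an element neutral for x0 is neutral for every y, since y = w + x0 for some w *)
  obtain z where z: "z \<in> univ M" "add M z x0 = x0" using solve[OF x0 x0] by blast
  have "add M z y = y" if "y \<in> univ M" for y
  proof -
    obtain w where w: "w \<in> univ M" "add M w x0 = y" using solve[OF x0 \<open>y \<in> univ M\<close>] by blast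
    have "add M z y = add M (add M z x0) w" using w z(1) x0 assoc comm by metis
    then show ?thesis using w z(2) x0 comm by metis
  qed
  then have "?zero z" using z(1) comm by metis
  then have "\<exists>!z. ?zero z" by metis
  then have one: "?zero \<one>\<^bsub>additive_group M\<^esub>"
    unfolding additive_group_def monoid.simps by (rule theI')
  show ?thesis
    by (rule comm_groupI) (use one closed assoc comm solve in auto)
qed

lemma (in group) generic_iff:
  "generic G X \<longleftrightarrow> X \<subseteq> carrier G \<and> (\<exists>C. finite C \<and> C \<subseteq> carrier G \<and>
     (\<forall>z\<in>carrier G. \<exists>g\<in>C. \<exists>x\<in>X. z = g \<otimes> x))"
proof (cases "X \<subseteq> carrier G")
  case True
  have "carrier G = (\<Union>g\<in>C. g <# X) \<longleftrightarrow> (\<forall>z\<in>carrier G. \<exists>g\<in>C. \<exists>x\<in>X. z = g \<otimes> x)"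
    if C: "C \<subseteq> carrier G" for C
  proof -
    have "(\<Union>g\<in>C. g <# X) \<subseteq> carrier G"
      using C l_coset_subset_G[OF True] by (intro UN_least) auto
    then have "carrier G = (\<Union>g\<in>C. g <# X) \<longleftrightarrow> (\<forall>z\<in>carrier G. z \<in> (\<Union>g\<in>C. g <# X))"
      by (metis subsetI subset_antisym)
    then show ?thesis by (simp add: l_coset_def)
  qed
  then show ?thesis using True unfolding generic_def by meson
qed (simp add: generic_def)

text \<open>If \<open>C (X \<union> Y) = G\<close>, then \<open>C Y\<close> contains the complement of \<open>C X\<close>. Were that complement generic,
  so would be \<open>Y\<close>.\<close>

lemma (in group) weakly_generic_imp_complement_not_generic:
  assumes "weakly_generic G X"
  shows "\<exists>C. finite C \<and> C \<subseteq> carrier G \<and>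
    \<not> generic G {z \<in> carrier G. \<forall>g\<in>C. \<forall>x\<in>X. z \<noteq> g \<otimes> x}"
proof -
  obtain Y where Y: "Y \<subseteq> carrier G" "\<not> generic G Y" "generic G (X \<union> Y)"
    using assms by (auto simp: weakly_generic_def)
  obtain C where C: "finite C" "C \<subseteq> carrier G"
    and cover: "\<forall>z\<in>carrier G. \<exists>g\<in>C. \<exists>x\<in>X \<union> Y. z = g \<otimes> x"
    using Y(3) by (auto simp: generic_iff)
  have "\<not> generic G {z \<in> carrier G. \<forall>g\<in>C. \<forall>x\<in>X. z \<noteq> g \<otimes> x}" (is "\<not> generic G ?W")
  proof
    assume "generic G ?W"
    then obtain D where D: "finite D" "D \<subseteq> carrier G"
      and coverW: "\<forall>z\<in>carrier G. \<exists>g\<in>D. \<exists>x\<in>?W. z = g \<otimes> x"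
      unfolding generic_iff by (elim conjE exE)
    let ?E = "(\<lambda>(d, c). d \<otimes> c) ` (D \<times> C)"
    have "\<exists>g\<in>?E. \<exists>y\<in>Y. z = g \<otimes> y" if z: "z \<in> carrier G" for z
    proof -
      obtain d w where d: "d \<in> D" "w \<in> ?W" "z = d \<otimes> w"
        using coverW z by blast
      then obtain c y where c: "c \<in> C" "y \<in> X \<union> Y" "w = c \<otimes> y"
        using cover by blast
      then have y: "y \<in> Y" using d(2) by blast
      have "d \<in> carrier G" "c \<in> carrier G" "y \<in> carrier G" using d(1) c(1) y D(2) C(2) Y(1) by auto
      then have "z = (d \<otimes> c) \<otimes> y" using d(3) c(3) by (simp add: m_assoc)
      then show ?thesis using d(1) c(1) y by force
    qed
    moreover have "?E \<subseteq> carrier G" using C(2) D(2) by auto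
    moreover have "finite ?E" using C(1) D(1) by simp
    ultimately have "generic G Y" using Y(1) unfolding generic_iff by blast
    then show False using Y(2) by contradiction
  qed
  then show ?thesis using C by blast
qed

lemma foldl_replicate_additive_group:
  assumes "comm_group (additive_group M)" "z \<in> univ M" "u \<in> univ M"
  shows "foldl (add M) z (replicate j u) = add M z (u [^]\<^bsub>additive_group M\<^esub> j)"
proof -
  interpret comm_group "additive_group M" by fact
  have "foldl (add M) z (replicate j u) = z \<otimes>\<^bsub>additive_group M\<^esub> (u [^]\<^bsub>additive_group M\<^esub> j)"
  proof (induction j)
    case 0
    then show ?case using r_one[of z] assms by simp
  next
    case (Suc j)
    then show ?case using m_assoc[of z "u [^]\<^bsub>additive_group M\<^esub> j" u] nat_pow_closed[of u j] assms
      by (simp flip: replicate_append_same)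
  qed
  then show ?thesis by simp
qed

text \<open>For \<open>c i = - g\<close>, where \<open>g\<close> runs through \<open>C\<close>, the shifting property says that every \<open>z\<close> has one of the
  shifts \<open>z + j u\<close>, \<open>j < P\<close>, outside \<open>C + A\<close>; so the translates by \<open>- j u\<close> of the complement of
  \<open>C + A\<close> cover the group.\<close>

lemma pred_not_weakly_generic:
  assumes M: "is_model M (theory_of int_struct)"
  shows "\<not> weakly_generic (additive_group M) (pred M)"
proof
  let ?G = "additive_group M"
  interpret comm_group ?G using M by (rule comm_group_additive_group)
  assume "weakly_generic ?G (pred M)"
  then obtain C where C: "finite C" "C \<subseteq> carrier ?G"
    and W: "\<not> generic ?G {z \<in> carrier ?G. \<forall>g\<in>C. \<forall>x\<in>pred M. z \<noteq> g \<otimes>\<^bsub>?G\<^esub> x}"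
      (is "\<not> generic ?G ?W")
    using weakly_generic_imp_complement_not_generic by blast
  from finite_list[OF C(1)] obtain cs where cs: "set cs = C" by blast
  (* the transferred property needs an element for every index; beyond the list any will do *)
  define c where "c i = (if i < length cs then inv\<^bsub>?G\<^esub> (cs ! i) else \<one>\<^bsub>?G\<^esub>)" for i
  have "c i \<in> univ M" for i
  proof -
    have "cs ! i \<in> carrier ?G" if "i < length cs" using that cs C(2) nth_mem by blast
    then have "c i \<in> carrier ?G" by (simp add: c_def del: additive_group_sel)
    then show ?thesis by simp
  qed
  from ex_shift_avoiding_translates_in_model[where c = c and n = "length cs", OF M this]
  obtain P u where u: "u \<in> univ M"
    and esc: "\<forall>z\<in>univ M. \<exists>j<P. \<forall>i<length cs. 
      add M (foldl (add M) z (replicate j u)) (c i) \<notin> pred M"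
    by blast
  define D where "D = (\<lambda>j. inv\<^bsub>?G\<^esub> (u [^]\<^bsub>?G\<^esub> j)) ` {..<P}"
  have u': "u [^]\<^bsub>?G\<^esub> j \<in> carrier ?G" for j :: nat using u by (intro nat_pow_closed) simp
  have D: "D \<subseteq> carrier ?G" using u' unfolding D_def by blast
  have "\<exists>g\<in>D. \<exists>w\<in>?W. z = g \<otimes>\<^bsub>?G\<^esub> w" if z: "z \<in> carrier ?G" for z
  proof -
    obtain j where j: "j < P" "\<And>i. i < length cs \<Longrightarrow>
        add M (foldl (add M) z (replicate j u)) (c i) \<notin> pred M"
      using esc z by auto
    define w where "w = z \<otimes>\<^bsub>?G\<^esub> (u [^]\<^bsub>?G\<^esub> j)"
    have w: "w \<in> carrier ?G" unfolding w_def using z u' by (intro m_closed)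
    have out: "w \<otimes>\<^bsub>?G\<^esub> inv\<^bsub>?G\<^esub> g \<notin> pred M" if "g \<in> C" for g
    proof -
      have "g \<in> set cs" using that cs by simp
      then obtain i where i: "i < length cs" "cs ! i = g" by (auto simp: in_set_conv_nth)
      have "c i = inv\<^bsub>?G\<^esub> g" unfolding c_def i(2) using i(1) by (rule if_P)
      then have "add M (foldl (add M) z (replicate j u)) (inv\<^bsub>?G\<^esub> g) \<notin> pred M"
        using j(2)[OF i(1)] by simp
      moreover have "foldl (add M) z (replicate j u) = w"
        using foldl_replicate_additive_group[OF comm_group_axioms, of z u j] z u
        by (simp only: w_def additive_group_sel)
      ultimately show ?thesis by simp
    qed
    have "w \<noteq> g \<otimes>\<^bsub>?G\<^esub> x" if g: "g \<in> C" "x \<in> pred M" for g x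
    proof
      assume wgx: "w = g \<otimes>\<^bsub>?G\<^esub> x"
      have gc: "g \<in> carrier ?G" using g(1) C(2) by blast
      have xc: "x \<in> carrier ?G" using g(2) M by (auto simp: is_model_def is_struct_def)
      have "w \<otimes>\<^bsub>?G\<^esub> inv\<^bsub>?G\<^esub> g = x"
        unfolding wgx m_comm[OF gc xc] 
        using m_assoc[OF xc gc inv_closed[OF gc]] r_inv[OF gc] r_one[OF xc] by (simp only:)
      then show False using out[OF g(1)] g(2) by simp
    qed
    then have "w \<in> ?W" using w by blast
    moreover have "z = inv\<^bsub>?G\<^esub> (u [^]\<^bsub>?G\<^esub> j) \<otimes>\<^bsub>?G\<^esub> w"
      unfolding w_def m_comm[OF z u']
      using m_assoc[OF inv_closed[OF u'[of j]] u'[of j] z] l_inv[OF u'[of j]] l_one[OF z] by (simp only:)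
    ultimately show ?thesis using j(1) unfolding D_def by blast
  qed
  moreover have "finite D" by (simp add: D_def)
  ultimately have "generic ?G ?W" using D unfolding generic_iff by blast
  then show False using W by contradiction
qed

text \<open>The sequences in \<open>chi\<close> start at index 1, those in the sums at index 0; this is the reason for \<open>Suc\<close>.
  That the product is in the carrier is included for the induction.\<close>

lemma (in monoid) chi_eq_foldl:
  assumes "a 1 = d" "\<And>i. 2 \<le> i \<Longrightarrow> i \<le> m + 1 \<Longrightarrow> a i = \<one>"
    and "\<And>i. 1 \<le> i \<Longrightarrow> i \<le> m \<Longrightarrow> t i = p + i"
    and "d \<in> carrier G" "\<And>s. f (Suc s) \<in> carrier G"
  shows "chi G m a t f = foldl (\<otimes>) d (map (\<lambda>s. f (Suc s)) [p..<p + m]) \<and>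
    chi G m a t f \<in> carrier G"
  using assms(2,3)
proof (induction m)
  case 0
  then show ?case using assms by simp
next
  case (Suc m)
  have IH: "chi G m a t f = foldl (\<otimes>) d (map (\<lambda>s. f (Suc s)) [p..<p + m])"
    "chi G m a t f \<in> carrier G"
    using Suc by auto
  have "a (Suc (Suc m)) = \<one>" "t (Suc m) = Suc (p + m)" using Suc.prems by auto
  then show ?case using IH assms(5) by simp
qed

lemma pred_J_set:
  fixes M :: "'a struct"
  assumes M: "is_model M (theory_of int_struct)"
  shows "J_set (additive_group M) (pred M)"
  unfolding J_set_def
proof (intro conjI allI impI)
  let ?G = "additive_group M"
  interpret comm_group ?G using M by (rule comm_group_additive_group)
  show "pred M \<subseteq> carrier ?G" using M by (simp add: is_model_def is_struct_def)
  fix F :: "(nat \<Rightarrow> 'a) set" assume F: "finite F \<and> F \<subseteq> ({1..} \<rightarrow>\<^sub>E carrier ?G)"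
  then have "finite F" by (rule conjunct1)
  from finite_list[OF this] obtain fs where fs: "set fs = F" by blast
  define y where "y i s = (if i < length fs then (fs ! i) (Suc s) else \<one>\<^bsub>?G\<^esub>)" for i s
  have fc: "f (Suc s) \<in> carrier ?G" if "f \<in> F" for f s
  proof -
    have "f \<in> {1..} \<rightarrow>\<^sub>E carrier ?G" using that F by blast
    then show ?thesis by (rule PiE_mem) simp
  qed
  have "y i s \<in> univ M" for i s
  proof (cases "i < length fs")
    case True
    then have "fs ! i \<in> F" using fs nth_mem by blast
    then show ?thesis using fc[of "fs ! i" s] True by (simp only: y_def if_True additive_group_sel)
  next
    case False
    then show ?thesis using one_closed by (simp only: y_def if_False additive_group_sel)
  qed
  from ex_block_sum_translate_in_model[where y = y and n = "length fs", OF M this]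
  obtain p q d where pq: "p < q" and d: "d \<in> univ M"
    and in_A: "\<forall>i<length fs. foldl (add M) d (map (y i) [p..<q]) \<in> pred M"
    by blast
  define m where "m = q - p"
  define t where "t = (\<lambda>i\<in>{1..m}. p + i)"
  define a where "a = (\<lambda>i\<in>{1..m + 1}. if i = 1 then d else \<one>\<^bsub>?G\<^esub>)"
  have m: "1 \<le> m" "p + m = q" using pq by (auto simp: m_def)
  have t: "t \<in> incr_tuples m" by (auto simp: incr_tuples_def t_def strict_mono_on_def)
  have a: "a \<in> {1..m + 1} \<rightarrow>\<^sub>E carrier ?G" using d one_closed by (auto simp: a_def)
  have "chi ?G m a t f \<in> pred M" if f: "f \<in> F" for f
  proof -
    have "f \<in> set fs" using f fs by simp
    then obtain i where i: "i < length fs" "fs ! i = f" by (auto simp: in_set_conv_nth)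
    have "chi ?G m a t f = foldl (add M) d (map (\<lambda>s. f (Suc s)) [p..<p + m])"
      using chi_eq_foldl[of a d m t p f] d fc[OF f] by (simp add: a_def t_def)
    also have "(\<lambda>s. f (Suc s)) = y i"
      using i by (simp add: y_def fun_eq_iff)
    also have "[p..<p + m] = [p..<q]" using m by simp
    finally show ?thesis using in_A i(1) by simp
  qed
  then show "\<exists>m\<ge>1. \<exists>t\<in>incr_tuples m. \<exists>a\<in>{1..m + 1} \<rightarrow>\<^sub>E carrier ?G. \<forall>f\<in>F. chi ?G m a t f \<in> pred M"
    using m t a by blast
qed

lemma definable_pred:
  assumes "is_struct M"
  shows "definable M (pred M)"
  unfolding definable_def
  by (rule exI[of _ "Pred (Var 0)"], rule exI[of _ "[]"]) (use assms in \<open>auto simp: is_struct_def\<close>)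

theorem proposition4p7:
  fixes M :: "'a struct"
  assumes "is_model M (theory_of int_struct)"
    and "aleph0_saturated M"
  shows "\<not> J_property_in M (additive_group M)"
proof
  assume "J_property_in M (additive_group M)"
  moreover have "is_struct M" using assms(1) by (simp add: is_model_def)
  then have "definable M (pred M)" "pred M \<subseteq> carrier (additive_group M)"
    by (auto simp: definable_pred is_struct_def)
  ultimately have "weakly_generic (additive_group M) (pred M)"
    using pred_J_set[OF assms(1)] unfolding J_property_in_def by blast
  then show False using pred_not_weakly_generic[OF assms(1)] by contradiction
qed

end
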